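(* Let $Q$ be a nonempty weakly compact convex subset of a Banach space $X$ and let $(S,Q)$ be a nonexpansive and norm-distal dynamical system, where $Q$ carries the weak topology. Then there is a fixed point of $S$ in $Q$, i.e. a point $x\in Q$ with $sx=x$ for every $s\in S$.
   Context: A dynamical system $(S,Q)$ consists of a semigroup $S$, a topological space $Q$ and a semigroup action $S\times Q\to Q$, $(s,x)\mapsto sx$ (so $(st)x=s(tx)$), such that for each $s\in S$ the map $Q\ni x\mapsto sx\in Q$ is continuous in the topology of $Q$ (here the weak topology of $X$). It is nonexpansive if $\|sx-sy\|\le\|x-y\|$ for all $s\in S$, $x,y\in Q$, and norm-distal if for every pair of distinct $x,y\in Q$, $0$ does not belong to the norm closure of $\{sx-sy:s\in S\}$. *)

theory Defs
  imports "HOL-Analysis.Analysis"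
begin

text \<open>The initial topology on \<^typ>\<open>'a\<close> with respect to the continuous linear functionals.\<close>

definition weak_topology :: "'a::real_normed_vector topology"
  where "weak_topology =
    topology_generated_by {f -` U | (f :: 'a \<Rightarrow> real) U. bounded_linear f \<and> open U}"

text \<open>A semigroup is an explicit carrier set with an operation, so that subsemigroups of
  an ambient type are covered; the operation is unconstrained outside the carrier.\<close>

definition semigroup_on :: "'s set \<Rightarrow> ('s \<Rightarrow> 's \<Rightarrow> 's) \<Rightarrow> bool"
  where "semigroup_on S mul \<longleftrightarrow>
    (\<forall>s\<in>S. \<forall>t\<in>S. mul s t \<in> S) \<and>
    (\<forall>s\<in>S. \<forall>t\<in>S. \<forall>u\<in>S. mul (mul s t) u = mul s (mul t u))"

text \<open>The phase space is the topological space \<open>Q\<close>, with underlying set \<^term>\<open>topspace Q\<close>.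
  Continuity of each \<open>act s\<close> includes that it maps this set into itself.\<close>

definition dynamical_system ::
    "'s set \<Rightarrow> ('s \<Rightarrow> 's \<Rightarrow> 's) \<Rightarrow> 'x topology \<Rightarrow> ('s \<Rightarrow> 'x \<Rightarrow> 'x) \<Rightarrow> bool"
  where "dynamical_system S mul Q act \<longleftrightarrow>
    semigroup_on S mul \<and>
    (\<forall>s\<in>S. \<forall>t\<in>S. \<forall>x\<in>topspace Q. act (mul s t) x = act s (act t x)) \<and>
    (\<forall>s\<in>S. continuous_map Q Q (act s))"

definition nonexpansive_action ::
    "'s set \<Rightarrow> 'a::real_normed_vector set \<Rightarrow> ('s \<Rightarrow> 'a \<Rightarrow> 'a) \<Rightarrow> bool"
  where "nonexpansive_action S Q act \<longleftrightarrow>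
    (\<forall>s\<in>S. \<forall>x\<in>Q. \<forall>y\<in>Q. norm (act s x - act s y) \<le> norm (x - y))"

text \<open>The closure below is taken in the norm topology, not in the weak topology.\<close>

definition norm_distal ::
    "'s set \<Rightarrow> 'a::real_normed_vector set \<Rightarrow> ('s \<Rightarrow> 'a \<Rightarrow> 'a) \<Rightarrow> bool"
  where "norm_distal S Q act \<longleftrightarrow>
    (\<forall>x\<in>Q. \<forall>y\<in>Q. x \<noteq> y \<longrightarrow> 0 \<notin> closure {act s x - act s y | s. s \<in> S})"

end

theory Submission
  imports Defs
begin

text \<open>
  On a minimal invariant set, distality turns the nonexpansive maps into isometries and makes the set
  totally bounded in norm; an elementary centre argument then shows that the set is a single point.

  \<^emph>\<open>Reduction to countable semigroups.\<close> The fixed point set of each \<open>s\<close> is weakly closed, because \<open>s\<close> is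
  weakly continuous and the weak topology is Hausdorff. By weak compactness of \<open>Q\<close> it is enough to
  find a common fixed point of finitely many elements, and these generate a countable semigroup.

  \<^emph>\<open>A minimal set is norm totally bounded.\<close> Choose a minimal nonempty weakly closed invariant set \<open>M\<close>
  inside a minimal nonempty weakly closed convex invariant set \<open>K\<close>. As \<open>M\<close> lies in the closed convex
  hull of one countable orbit, it is norm separable, so Baire's theorem provides nonempty relatively
  weakly open pieces of \<open>M\<close> of arbitrarily small norm diameter. By minimality any point of \<open>M\<close> can be
  moved into such a piece. Hence, if some pointwise weak limit \<open>p\<close> of elements of \<open>S\<close> identified two
  points of \<open>M\<close>, elements of \<open>S\<close> would bring these points arbitrarily close in norm, against
  norm-distality (\<open>enveloping_injective\<close>). So the compact semigroup of all these limits consists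
  of injective maps. By the Ellis--Numakura lemma it contains an idempotent, which must be the identity,
  and it follows that it is a group (\<open>compact_injective_semigroup_inverse\<close>). Its elements and their
  inverses are nonexpansive: \<open>S\<close> acts on \<open>M\<close> by surjective isometries. Finitely many preimages of one
  small piece cover \<open>M\<close>, and being isometric copies of parts of it they are small as well
  (\<open>finite_net\<close>).

  \<^emph>\<open>The centre argument.\<close> If \<open>M\<close> had two points, the mean of a fine finite net of \<open>M\<close> would have
  distance at most \<open>r\<close> from all of \<open>M\<close>, for some \<open>r\<close> below the diameter of \<open>M\<close>. The points of \<open>K\<close>
  with this property form a weakly closed convex set, invariant because \<open>S\<close> is nonexpansive and maps
  \<open>M\<close> onto itself. It would be all of \<open>K \<supseteq> M\<close>, so the diameter of \<open>M\<close> would be at most \<open>r\<close>.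

  Balls, closed convex hulls and the set of centres are weakly closed because norm-closed convex sets
  are (\<open>closed_convex_imp_weakly_closed\<close>). This comes from a form of the Hahn--Banach theorem in which the
  functional is a minimal element among all sublinear functionals below a given one.
\<close>

section \<open>The Hahn--Banach theorem and the weak topology\<close>

text \<open>Positive homogeneity is required only as an inequality, which passes to infima directly; applied
  to \<open>a\<close> and \<open>1/a\<close> it gives equality.\<close>

definition sublinear :: "('a::real_vector \<Rightarrow> real) \<Rightarrow> bool"
  where "sublinear q \<longleftrightarrow>
    (\<forall>v w. q (v + w) \<le> q v + q w) \<and> (\<forall>a>0. \<forall>v. q (a *\<^sub>R v) \<le> a * q v)"

lemma sublinear_add: "sublinear q \<Longrightarrow> q (v + w) \<le> q v + q w"
  by (simp add: sublinear_def)

lemma sublinear_zero: "sublinear q \<Longrightarrow> q 0 = 0"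
proof -
  assume q: "sublinear q"
  then have "q (2 *\<^sub>R 0) \<le> 2 * q 0" "q ((1/2) *\<^sub>R 0) \<le> (1/2) * q 0"
    unfolding sublinear_def by (simp_all only: zero_less_numeral half_gt_zero zero_less_one)
  then show "q 0 = 0" by simp
qed

lemma sublinear_scale:
  assumes "sublinear q" "a \<ge> 0"
  shows "q (a *\<^sub>R v) = a * q v"
proof (cases "a = 0")
  case True
  then show ?thesis using sublinear_zero[OF assms(1)] by simp
next
  case False
  then have a: "a > 0" using assms by simp
  then have "q ((1/a) *\<^sub>R (a *\<^sub>R v)) \<le> (1/a) * q (a *\<^sub>R v)"
    using assms unfolding sublinear_def by (metis divide_pos_pos zero_less_one)
  then have "a * q v \<le> q (a *\<^sub>R v)"
    using a by (simp add: field_simps)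
  moreover have "q (a *\<^sub>R v) \<le> a * q v"
    using assms a unfolding sublinear_def by blast
  ultimately show ?thesis by simp
qed

lemma sublinear_lower: "sublinear q \<Longrightarrow> - q (- v) \<le> q v"
  using sublinear_add[of q v "- v"] sublinear_zero[of q] by simp

text \<open>All three infima of the Hahn--Banach argument have this shape: the infimum along a chain,
  the infimum that forces additivity and the gauge used for separation.\<close>

lemma sublinear_INF:
  fixes g :: "'i \<Rightarrow> 'a::real_vector \<Rightarrow> real"
  assumes ne: "T \<noteq> {}"
    and below: "\<And>i v. i \<in> T \<Longrightarrow> m v \<le> g i v"
    and add: "\<And>i j v w. i \<in> T \<Longrightarrow> j \<in> T \<Longrightarrow> \<exists>k\<in>T. g k (v + w) \<le> g i v + g j w"
    and scale: "\<And>i a v. i \<in> T \<Longrightarrow> a > 0 \<Longrightarrow> \<exists>k\<in>T. g k (a *\<^sub>R v) \<le> a * g i v"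
  shows "sublinear (\<lambda>v. INF i\<in>T. g i v)" (is "sublinear ?I")
proof -
  have lower: "?I v \<le> g i v" if "i \<in> T" for i v
    using that below by (intro cINF_lower bdd_belowI2)
  have "?I (v + w) \<le> ?I v + ?I w" for v w
  proof -
    have *: "?I (v + w) \<le> g i v + g j w" if "i \<in> T" "j \<in> T" for i j
      using add[OF that, of v w] lower[of _ "v + w"] by force
    have "?I (v + w) - g i v \<le> ?I w" if "i \<in> T" for i
      using *[OF that] ne by (intro cINF_greatest) (auto simp: algebra_simps)
    then have "?I (v + w) - ?I w \<le> ?I v"
      using ne by (intro cINF_greatest) (auto simp: algebra_simps)
    then show ?thesis by simp
  qed
  moreover have "?I (a *\<^sub>R v) \<le> a * ?I v" if "a > 0" for a v
  proof -
    have "?I (a *\<^sub>R v) / a \<le> g i v" if i: "i \<in> T" for i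
      using scale[OF i \<open>a > 0\<close>, of v] lower[of _ "a *\<^sub>R v"] \<open>a > 0\<close>
      by (force simp: field_simps)
    then have "?I (a *\<^sub>R v) / a \<le> ?I v"
      using ne by (intro cINF_greatest)
    then show ?thesis using \<open>a > 0\<close> by (simp add: field_simps)
  qed
  ultimately show ?thesis unfolding sublinear_def by blast
qed

text \<open>Replacing \<open>q v\<close> by the infimum of \<open>q (v + t y) - t q y\<close> over \<open>t \<ge> 0\<close> lowers a sublinear
  functional and is forced to change nothing when \<open>q\<close> is minimal; \<open>t = 1\<close> then gives the missing
  inequality \<open>q v + q y \<le> q (v + y)\<close>.\<close>

lemma minimal_sublinear_is_linear:
  fixes q :: "'a::real_vector \<Rightarrow> real"
  assumes q: "sublinear q"
    and min: "\<And>r. sublinear r \<Longrightarrow> r \<le> q \<Longrightarrow> r = q"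
  shows "linear q"
proof -
  have super: "q v + q y \<le> q (v + y)" for v y
  proof -
    define g where "g = (\<lambda>t v. q (v + t *\<^sub>R y) - t * q y)"
    define r where "r = (\<lambda>v. INF t\<in>{0..}. g t v)"
    have below: "- q (- v) \<le> g t v" if "t \<in> {0..}" for t v
      using sublinear_add[OF q, of "v + t *\<^sub>R y" "- v"] sublinear_scale[OF q, of t y] that
      by (simp add: g_def)
    have r: "sublinear r"
      unfolding r_def
    proof (rule sublinear_INF[OF _ below])
      fix i j :: real and v w assume "i \<in> {0..}" "j \<in> {0..}"
      then show "\<exists>k\<in>{0..}. g k (v + w) \<le> g i v + g j w"
        using sublinear_add[OF q, of "v + i *\<^sub>R y" "w + j *\<^sub>R y"]
        by (intro bexI[of _ "i + j"]) (auto simp: g_def algebra_simps)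
    next
      fix i a :: real and v assume "i \<in> {0..}" "a > 0"
      then show "\<exists>k\<in>{0..}. g k (a *\<^sub>R v) \<le> a * g i v"
        using sublinear_scale[OF q, of a "v + i *\<^sub>R y"]
        by (intro bexI[of _ "a * i"]) (auto simp: g_def algebra_simps)
    qed auto
    have r_le: "r v \<le> g t v" if "t \<ge> 0" for t v
      unfolding r_def using that below by (intro cINF_lower bdd_belowI2) auto
    then have "r \<le> q"
      using r_le[of 0] by (auto simp: g_def le_fun_def)
    then have "r = q" using min r by blast
    then show ?thesis using r_le[of 1 v] by (simp add: g_def)
  qed
  have add: "q (v + w) = q v + q w" for v w
    using super sublinear_add[OF q] by (simp add: antisym)
  have neg: "q (- v) = - q v" for v
    using add[of v "- v"] sublinear_zero[OF q] by simp
  have "q (a *\<^sub>R v) = a * q v" for a v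
  proof (cases "a \<ge> 0")
    case False
    then show ?thesis
      using sublinear_scale[OF q, of "- a" v] neg[of "a *\<^sub>R v"] by simp
  qed (simp add: sublinear_scale[OF q])
  then show ?thesis using add by (intro linearI) auto
qed

lemma linear_below_sublinear:
  fixes p :: "'a::real_vector \<Rightarrow> real"
  assumes p: "sublinear p"
  obtains f where "linear f" "\<And>v. f v \<le> p v"
proof -
  define A where "A = {q. sublinear q \<and> q \<le> p}"
  have "\<exists>m\<in>A. \<forall>q\<in>A. q \<le> m \<longrightarrow> q = m"
  proof (rule predicate_Zorn[where P = "\<lambda>q r. r \<le> q"])
    show "partial_order_on A (relation_of (\<lambda>q r. r \<le> q) A)"
      by (intro partial_order_on_relation_ofI) auto
    fix C assume C: "C \<in> Chains (relation_of (\<lambda>q r. r \<le> q) A)"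
    have CA: "C \<subseteq> A" and tot: "\<And>q r. q \<in> C \<Longrightarrow> r \<in> C \<Longrightarrow> q \<le> r \<or> r \<le> q"
      using C by (auto simp: Chains_def relation_of_def)
    show "\<exists>u\<in>A. \<forall>a\<in>C. u \<le> a"
    proof (cases "C = {}")
      case True
      then show ?thesis using p by (auto simp: A_def)
    next
      case False
      define u where "u = (\<lambda>v. INF q\<in>C. q v)"
      have below: "- p (- v) \<le> q v" if "q \<in> C" for q v
      proof -
        have "sublinear q" "q (- v) \<le> p (- v)" using that CA by (auto simp: A_def le_fun_def)
        then show ?thesis using sublinear_lower[of q v] by simp
      qed
      have u: "sublinear u"
        unfolding u_def
      proof (rule sublinear_INF[OF False below])
        fix q r v w assume "q \<in> C" "r \<in> C"
        then obtain k where k: "k \<in> C" "k \<le> q" "k \<le> r" using tot by blast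
        then have "k (v + w) \<le> k v + k w" "k v \<le> q v" "k w \<le> r w"
          using CA by (auto simp: A_def le_fun_def sublinear_add)
        then show "\<exists>k\<in>C. k (v + w) \<le> q v + r w"
          using k(1) by (intro bexI[of _ k]) auto
      next
        fix q a v assume "q \<in> C" "(a::real) > 0"
        then show "\<exists>k\<in>C. k (a *\<^sub>R v) \<le> a * q v"
          using CA by (intro bexI[of _ q]) (auto simp: A_def sublinear_def)
      qed
      have le: "u \<le> q" if "q \<in> C" for q
        unfolding u_def le_fun_def using that below by (intro allI cINF_lower bdd_belowI2)
      have "u \<in> A"
        using u le False CA by (force simp: A_def)
      then show ?thesis using le by blast
    qed
  qed
  then obtain m where m: "m \<in> A" and min: "\<And>q. q \<in> A \<Longrightarrow> q \<le> m \<Longrightarrow> q = m" by blast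
  have "linear m"
  proof (rule minimal_sublinear_is_linear)
    show "sublinear m" using m by (simp add: A_def)
    fix r assume "sublinear r" "r \<le> m"
    then show "r = m" using m min by (auto simp: A_def)
  qed
  then show thesis using that[of m] m by (auto simp: A_def le_fun_def)
qed

text \<open>The infimum \<open>p v\<close> of \<open>\<parallel>v + t (c - x)\<parallel> - t \<delta>\<close> over \<open>t \<ge> 0\<close> and \<open>c \<in> C\<close> is at most the norm, and it
  is finite because \<open>\<delta>\<close> is the distance of \<open>x\<close> from \<open>C\<close>. The pair \<open>t = 1\<close> and \<open>c\<close> shows that
  \<open>p (x - c) \<le> - \<delta>\<close>, so a linear functional below \<open>p\<close> is bounded and separates.\<close>

lemma closed_convex_separation:
  fixes C :: "'a::real_normed_vector set"
  assumes C: "closed C" "convex C" and x: "x \<notin> C"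
  obtains f :: "'a \<Rightarrow> real" and b where "bounded_linear f" "f x < b" "\<And>c. c \<in> C \<Longrightarrow> b \<le> f c"
proof (cases "C = {}")
  case True
  then show thesis using that[of "\<lambda>_. 0" 1] by simp
next
  case False
  define \<delta> where "\<delta> = infdist x C"
  have \<delta>: "\<delta> > 0"
    using C(1) x False unfolding \<delta>_def by (simp add: infdist_pos_not_in_closed)
  have dist: "\<delta> \<le> norm (c - x)" if "c \<in> C" for c
    using infdist_le[OF that, of x] by (simp add: \<delta>_def dist_norm norm_minus_commute)
  define g where "g = (\<lambda>(t, c) v. norm (v + t *\<^sub>R (c - x)) - t * \<delta>)"
  define p where "p = (\<lambda>v. INF i\<in>{0..} \<times> C. g i v)"
  have below: "- norm v \<le> g i v" if i: "i \<in> {0..} \<times> C" for i v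
  proof -
    obtain t c where tc: "i = (t, c)" "t \<ge> 0" "c \<in> C" using i by auto
    have "t * \<delta> \<le> norm (t *\<^sub>R (c - x))"
      using dist[OF tc(3)] tc(2) by (simp add: mult_left_mono)
    also have "\<dots> \<le> norm (v + t *\<^sub>R (c - x)) + norm v"
      by (metis add_diff_cancel_left' norm_triangle_ineq4)
    finally show ?thesis by (simp add: g_def tc)
  qed
  have p: "sublinear p"
    unfolding p_def
  proof (rule sublinear_INF[OF _ below])
    fix i j :: "real \<times> 'a" and v w assume "i \<in> {0..} \<times> C" "j \<in> {0..} \<times> C"
    then obtain s c t d where i: "i = (s, c)" "s \<ge> 0" "c \<in> C" and j: "j = (t, d)" "t \<ge> 0" "d \<in> C"
      by auto
    obtain e where e: "e \<in> C" "(s + t) *\<^sub>R e = s *\<^sub>R c + t *\<^sub>R d"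
    proof (cases "s + t = 0")
      case True
      then have "s = 0" "t = 0" using i j by auto
      then show thesis using that[of c] i by simp
    next
      case False
      then have st: "s + t > 0" using i j by simp
      then have "s / (s + t) + t / (s + t) = 1"
        by (metis add_divide_distrib divide_self less_irrefl)
      then have "(s / (s + t)) *\<^sub>R c + (t / (s + t)) *\<^sub>R d \<in> C"
        using i j st by (intro convexD[OF C(2)]) auto
      then show thesis
        by (rule that) (use False in \<open>simp add: scaleR_right_distrib\<close>)
    qed
    have "(s + t) *\<^sub>R (e - x) = s *\<^sub>R (c - x) + t *\<^sub>R (d - x)"
      using e(2) by (simp add: algebra_simps)
    then have "v + w + (s + t) *\<^sub>R (e - x) = (v + s *\<^sub>R (c - x)) + (w + t *\<^sub>R (d - x))"
      by simp
    then have "g (s + t, e) (v + w) \<le> g i v + g j w"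
      using norm_triangle_ineq[of "v + s *\<^sub>R (c - x)" "w + t *\<^sub>R (d - x)"]
      by (simp add: g_def i j algebra_simps)
    then show "\<exists>k\<in>{0..} \<times> C. g k (v + w) \<le> g i v + g j w"
      using e(1) i j by (intro bexI[of _ "(s + t, e)"]) auto
  next
    fix i :: "real \<times> 'a" and a v assume "i \<in> {0..} \<times> C" and a: "(a::real) > 0"
    then obtain t c where i: "i = (t, c)" "t \<ge> 0" "c \<in> C" by auto
    have "norm (a *\<^sub>R v + (a * t) *\<^sub>R (c - x)) = a * norm (v + t *\<^sub>R (c - x))"
      using a by (metis abs_of_pos norm_scaleR scaleR_right_distrib scaleR_scaleR)
    then show "\<exists>k\<in>{0..} \<times> C. g k (a *\<^sub>R v) \<le> a * g i v"
      using i a by (intro bexI[of _ "(a * t, c)"]) (auto simp: g_def right_diff_distrib)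
  qed (use False in auto)
  have p_le: "p v \<le> g i v" if "i \<in> {0..} \<times> C" for i v
    unfolding p_def using that below by (intro cINF_lower bdd_belowI2)
  obtain f where f: "linear f" "\<And>v. f v \<le> p v"
    using linear_below_sublinear[OF p] by blast
  have f_norm: "f v \<le> norm v" for v
  proof -
    obtain c where "c \<in> C" using False by blast
    then show ?thesis using f(2)[of v] p_le[of "(0, c)" v] by (simp add: g_def)
  qed
  have "\<bar>f v\<bar> \<le> norm v" for v
    using f_norm[of v] f_norm[of "- v"] linear_neg[OF f(1), of v] by simp
  then have bl: "bounded_linear f"
    using f(1) by (intro bounded_linear_intro[of f 1]) (auto simp: linear_add linear_cmul)
  have "f x + \<delta> \<le> f c" if c: "c \<in> C" for c
    using f(2)[of "x - c"] p_le[of "(1, c)" "x - c"] c linear_diff[OF f(1), of x c]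
    by (simp add: g_def)
  then show thesis using that[OF bl, of "f x + \<delta>"] \<delta> by simp
qed

lemma topspace_weak_topology [simp]: "topspace weak_topology = (UNIV :: 'a::real_normed_vector set)"
proof -
  have "(\<lambda>_::'a. 0::real) -` UNIV \<in> {f -` U | (f :: 'a \<Rightarrow> real) U. bounded_linear f \<and> open U}"
    using bounded_linear_zero by blast
  then show ?thesis unfolding weak_topology_def by auto
qed

lemma continuous_map_weak_iff:
  fixes h :: "'x \<Rightarrow> 'a::real_normed_vector"
  shows "continuous_map X weak_topology h \<longleftrightarrow>
    (\<forall>f. bounded_linear f \<longrightarrow> continuous_map X euclideanreal (\<lambda>x. f (h x)))"
proof -
  have eq: "continuous_map X weak_topology h \<longleftrightarrow>
    (\<forall>f U. bounded_linear (f :: 'a \<Rightarrow> real) \<longrightarrow> open U \<longrightarrow> openin X (h -` (f -` U) \<inter> topspace X))"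
    using topspace_weak_topology[where 'a = 'a]
    unfolding weak_topology_def continuous_on_generated_topo_iff by auto
  have "h -` (f -` U) \<inter> topspace X = {x \<in> topspace X. f (h x) \<in> U}" for f :: "'a \<Rightarrow> real" and U
    by auto
  then show ?thesis unfolding eq by (auto simp: continuous_map_def)
qed

lemma continuous_map_weak_functional:
  fixes f :: "'a::real_normed_vector \<Rightarrow> real"
  assumes "bounded_linear f"
  shows "continuous_map weak_topology euclideanreal f"
  using assms continuous_map_weak_iff[of weak_topology "\<lambda>x::'a. x"] by simp

lemma continuous_map_weak_diff:
  fixes g h :: "'x \<Rightarrow> 'a::real_normed_vector"
  assumes "continuous_map X weak_topology g" "continuous_map X weak_topology h"
  shows "continuous_map X weak_topology (\<lambda>x. g x - h x)"
  using assms
  by (auto simp: continuous_map_weak_iff linear_diff bounded_linear.linear intro!: continuous_intros)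

lemma closed_convex_imp_weakly_closed:
  fixes C :: "'a::real_normed_vector set"
  assumes C: "closed C" "convex C"
  shows "closedin weak_topology C"
proof -
  have "\<exists>T. openin weak_topology T \<and> x \<in> T \<and> T \<subseteq> - C" if x: "x \<notin> C" for x
  proof -
    obtain f :: "'a \<Rightarrow> real" and b where f: "bounded_linear f" "f x < b" "\<And>c. c \<in> C \<Longrightarrow> b \<le> f c"
      using closed_convex_separation[OF C x] by metis
    have "openin weak_topology {y \<in> topspace weak_topology. f y \<in> {..<b}}"
      using continuous_map_weak_functional[OF f(1)] by (rule openin_continuous_map_preimage) simp
    then show ?thesis using f by (intro exI[of _ "{y. f y < b}"]) force+
  qed
  then have "openin weak_topology (- C)"
    by (subst openin_subopen) blast
  then show ?thesis by (simp add: closedin_def Compl_eq_Diff_UNIV)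
qed

lemma Hausdorff_weak_topology: "Hausdorff_space (weak_topology :: 'a::real_normed_vector topology)"
  unfolding Hausdorff_space_def
proof (intro allI impI, elim conjE)
  fix x y :: 'a assume "x \<noteq> y"
  then obtain f :: "'a \<Rightarrow> real" and b where f: "bounded_linear f" "f x < b" "b \<le> f y"
    using closed_convex_separation[of "{y}" x] by auto
  define c where "c = (f x + b) / 2"
  have "openin weak_topology {z \<in> topspace weak_topology. f z \<in> {..<c}}"
    "openin weak_topology {z \<in> topspace weak_topology. f z \<in> {c<..}}"
    using continuous_map_weak_functional[OF f(1)] by (rule openin_continuous_map_preimage; simp)+
  then show "\<exists>U V. openin weak_topology U \<and> openin weak_topology V \<and> x \<in> U \<and> y \<in> V \<and> disjnt U V"
    using f(2,3) by (intro exI[of _ "{z. f z < c}"] exI[of _ "{z. c < f z}"])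
      (auto simp: c_def disjnt_def)
qed

section \<open>Minimal closed sets and the Ellis semigroup\<close>

text \<open>Zorn's lemma, with compactness keeping the intersections of chains nonempty. It is used for closed
  subsemigroups, for invariant sets and for invariant convex sets.\<close>

lemma minimal_closed_set:
  assumes X: "compact_space X"
    and A: "closedin X A" "A \<noteq> {}" "P A"
    and Inter: "\<And>\<C>. \<C> \<noteq> {} \<Longrightarrow> (\<And>C. C \<in> \<C> \<Longrightarrow> C \<subseteq> A \<and> P C) \<Longrightarrow> P (\<Inter>\<C>)"
  obtains M where "closedin X M" "M \<noteq> {}" "P M" "M \<subseteq> A"
    "\<And>N. closedin X N \<Longrightarrow> N \<noteq> {} \<Longrightarrow> P N \<Longrightarrow> N \<subseteq> M \<Longrightarrow> N = M"
proof -
  define \<A> where "\<A> = {C. closedin X C \<and> C \<noteq> {} \<and> P C \<and> C \<subseteq> A}"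
  have "\<exists>M\<in>\<A>. \<forall>N\<in>\<A>. N \<subseteq> M \<longrightarrow> N = M"
  proof (rule predicate_Zorn[where P = "\<lambda>M N. N \<subseteq> M"])
    show "partial_order_on \<A> (relation_of (\<lambda>M N. N \<subseteq> M) \<A>)"
      by (intro partial_order_on_relation_ofI) auto
    fix \<C> assume C: "\<C> \<in> Chains (relation_of (\<lambda>M N. N \<subseteq> M) \<A>)"
    have CA: "\<C> \<subseteq> \<A>" and chain: "subset.chain UNIV \<C>"
      using C by (auto simp: Chains_def relation_of_def subset_chain_def)
    show "\<exists>U\<in>\<A>. \<forall>C\<in>\<C>. U \<subseteq> C"
    proof (cases "\<C> = {}")
      case True
      then show ?thesis using A by (auto simp: \<A>_def)
    next
      case False
      have "\<Inter>\<F> \<noteq> {}" if F: "finite \<F>" "\<F> \<subseteq> \<C>" for \<F>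
      proof (cases "\<F> = {}")
        case False
        have "subset.chain UNIV \<F>" using chain F(2) by (auto simp: subset_chain_def)
        then have "\<Inter>\<F> \<in> \<F>" using Inter_in_chain[OF F(1) False] by blast
        then show ?thesis using F(2) CA by (auto simp: \<A>_def)
      qed simp
      moreover have "\<forall>C\<in>\<C>. closedin X C" using CA by (auto simp: \<A>_def)
      ultimately have "\<Inter>\<C> \<noteq> {}" using X[unfolded compact_space_fip, THEN spec, of \<C>] by simp
      moreover have "closedin X (\<Inter>\<C>)"
        using False CA by (intro closedin_Inter) (auto simp: \<A>_def)
      moreover have "P (\<Inter>\<C>)"
        using False CA by (intro Inter) (auto simp: \<A>_def)
      moreover have "\<Inter>\<C> \<subseteq> A" using False CA by (auto simp: \<A>_def)
      ultimately have "\<Inter>\<C> \<in> \<A>" by (simp add: \<A>_def)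
      then show ?thesis by blast
    qed
  qed
  then obtain M where "M \<in> \<A>" "\<And>N. N \<in> \<A> \<Longrightarrow> N \<subseteq> M \<Longrightarrow> N = M" by blast
  then show thesis using that[of M] by (auto simp: \<A>_def)
qed

abbreviation self_map_topology :: "'a topology \<Rightarrow> ('a \<Rightarrow> 'a) topology"
  where "self_map_topology X \<equiv> product_topology (\<lambda>_. X) (topspace X)"

lemma continuous_map_evaluation:
  "x \<in> topspace X \<Longrightarrow> continuous_map (self_map_topology X) X (\<lambda>f. f x)"
  by (rule continuous_map_product_projection)

lemma continuous_map_compose_right:
  assumes "g \<in> topspace X \<rightarrow> topspace X"
  shows "continuous_map (self_map_topology X) (self_map_topology X) (\<lambda>f. compose (topspace X) f g)"
  unfolding continuous_map_componentwise
  using assms by (auto simp: compose_def Pi_iff intro!: continuous_map_evaluation)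

lemma continuous_map_compose_left:
  assumes "continuous_map X X h"
  shows "continuous_map (self_map_topology X) (self_map_topology X) (compose (topspace X) h)"
  unfolding continuous_map_componentwise
  using assms
  by (auto simp: compose_def intro!: continuous_map_compose[OF continuous_map_evaluation, unfolded o_def])

lemma self_map_memb: "f \<in> topspace (self_map_topology X) \<Longrightarrow> f \<in> topspace X \<rightarrow> topspace X"
  by auto

lemma self_map_compose_assoc:
  assumes "f \<in> topspace (self_map_topology X)"
  shows "compose (topspace X) h (compose (topspace X) g f) = compose (topspace X) (compose (topspace X) h g) f"
  using self_map_memb[OF assms] by (rule compose_assoc)

text \<open>Composition \<open>f \<circ> g\<close> of self-maps is continuous in \<open>f\<close> for every \<open>g\<close>, but in \<open>g\<close> only when \<open>f\<close> is
  continuous. So the closure is absorbed first in the right factor and then in the left one.\<close>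

lemma closure_of_closed_under_compose:
  assumes G: "G \<subseteq> topspace (self_map_topology X)"
    and cont: "\<And>g. g \<in> G \<Longrightarrow> continuous_map X X g"
    and comp: "\<And>f g. f \<in> G \<Longrightarrow> g \<in> G \<Longrightarrow> compose (topspace X) f g \<in> G"
    and f: "f \<in> self_map_topology X closure_of G" and g: "g \<in> self_map_topology X closure_of G"
  shows "compose (topspace X) f g \<in> self_map_topology X closure_of G" (is "_ \<in> ?E")
proof -
  have step: "compose (topspace X) h g \<in> ?E" if h: "h \<in> G" for h
  proof -
    have "compose (topspace X) h ` ?E \<subseteq> self_map_topology X closure_of (compose (topspace X) h ` G)"
      by (rule continuous_map_image_closure_subset[OF continuous_map_compose_left[OF cont[OF h]]])
    also have "\<dots> \<subseteq> ?E" using comp h by (intro closure_of_mono) auto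
    finally show ?thesis using g by blast
  qed
  have "g \<in> topspace X \<rightarrow> topspace X"
    by (rule self_map_memb[OF subsetD[OF closure_of_subset_topspace g]])
  then have "(\<lambda>f. compose (topspace X) f g) ` ?E
      \<subseteq> self_map_topology X closure_of ((\<lambda>f. compose (topspace X) f g) ` G)"
    by (intro continuous_map_image_closure_subset continuous_map_compose_right)
  also have "\<dots> \<subseteq> ?E" using step by (intro closure_of_minimal) auto
  finally show ?thesis using f by blast
qed

text \<open>The argument of Ellis and Numakura: in a minimal closed subsemigroup \<open>T\<close> containing \<open>e\<close>, first
  the closed subsemigroup \<open>T \<circ> e\<close> must be all of \<open>T\<close>, so \<open>{t \<in> T. t \<circ> e = e}\<close> is nonempty; it is again
  a closed subsemigroup, hence equal to \<open>T\<close> and contains \<open>e\<close>.\<close>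

lemma compact_self_map_semigroup_idempotent:
  assumes X: "compact_space X" "Hausdorff_space X"
    and E: "closedin (self_map_topology X) E" "E \<noteq> {}"
    and comp: "\<And>f g. f \<in> E \<Longrightarrow> g \<in> E \<Longrightarrow> compose (topspace X) f g \<in> E"
  obtains e where "e \<in> E" "compose (topspace X) e e = e"
proof -
  let ?P = "self_map_topology X" and ?c = "compose (topspace X)"
  define semi where "semi = (\<lambda>T. \<forall>f\<in>T. \<forall>g\<in>T. ?c f g \<in> T)"
  have cpt: "compact_space ?P"
    using X(1) by (simp add: compact_space_product_topology)
  have haus: "Hausdorff_space ?P"
    using X(2) by (simp add: Hausdorff_space_product_topology)
  obtain T where T: "closedin ?P T" "T \<noteq> {}" "semi T" "T \<subseteq> E"
    and min: "\<And>N. closedin ?P N \<Longrightarrow> N \<noteq> {} \<Longrightarrow> semi N \<Longrightarrow> N \<subseteq> T \<Longrightarrow> N = T"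
  proof (rule minimal_closed_set[OF cpt E, of semi])
    show "semi E" using comp by (simp add: semi_def)
  qed (auto simp: semi_def)
  obtain e where e: "e \<in> T" using T(2) by blast
  have sub: "T \<subseteq> topspace ?P" using T(1) closedin_subset by blast
  have assoc: "?c h (?c g f) = ?c (?c h g) f" if "f \<in> T" for f g h
    by (rule self_map_compose_assoc[OF subsetD[OF sub that]])
  have right: "continuous_map ?P ?P (\<lambda>f. ?c f e)"
    by (rule continuous_map_compose_right[OF self_map_memb[OF subsetD[OF sub e]]])
  have "(\<lambda>f. ?c f e) ` T = T"
  proof (rule min)
    show "closedin ?P ((\<lambda>f. ?c f e) ` T)"
      by (rule compactin_imp_closedin[OF haus image_compactin[OF closedin_compact_space[OF cpt T(1)] right]])
    show "semi ((\<lambda>f. ?c f e) ` T)"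
      unfolding semi_def
    proof (intro ballI)
      fix f g assume "f \<in> (\<lambda>f. ?c f e) ` T" "g \<in> (\<lambda>f. ?c f e) ` T"
      then obtain a b where ab: "a \<in> T" "b \<in> T" "f = ?c a e" "g = ?c b e" by blast
      then have "?c f g = ?c (?c f b) e" "?c f b \<in> T"
        using T(3) e assoc by (auto simp: semi_def)
      then show "?c f g \<in> (\<lambda>f. ?c f e) ` T" by blast
    qed
  qed (use T e in \<open>auto simp: semi_def\<close>)
  then obtain t where t: "t \<in> T" "?c t e = e" using e by (metis imageE)
  have "T \<inter> {f \<in> topspace ?P. ?c f e \<in> {e}} = T"
  proof (rule min)
    have "closedin ?P {e}" using haus e sub by (simp add: Hausdorff_imp_t1_space closedin_Hausdorff_singleton subset_iff)
    then show "closedin ?P (T \<inter> {f \<in> topspace ?P. ?c f e \<in> {e}})"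
      using T(1) right by (intro closedin_Int closedin_continuous_map_preimage)
    show "semi (T \<inter> {f \<in> topspace ?P. ?c f e \<in> {e}})"
      unfolding semi_def
    proof (intro ballI)
      fix f g assume f: "f \<in> T \<inter> {f \<in> topspace ?P. ?c f e \<in> {e}}"
        and g: "g \<in> T \<inter> {f \<in> topspace ?P. ?c f e \<in> {e}}"
      have "?c (?c f g) e = ?c f (?c g e)" by (rule assoc[OF e, symmetric])
      also have "\<dots> = e" using f g by simp
      finally show "?c f g \<in> T \<inter> {f \<in> topspace ?P. ?c f e \<in> {e}}"
        using f g T(3) sub by (auto simp: semi_def simp del: topspace_product_topology)
    qed
    show "T \<inter> {f \<in> topspace ?P. ?c f e \<in> {e}} \<noteq> {}" using t sub by blast
  qed auto
  then have "?c e e = e" using e by blast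
  then show thesis using that[of e] e T(4) by blast
qed

text \<open>An injective idempotent is the identity. For \<open>q\<close> in a closed semigroup \<open>E\<close> of injective maps,
  \<open>E \<circ> q\<close> is again such a semigroup, so it contains the identity: \<open>q\<close> has a left inverse, and that
  left inverse is injective as well, hence two-sided.\<close>

lemma compact_injective_semigroup_inverse:
  assumes X: "compact_space X" "Hausdorff_space X"
    and E: "closedin (self_map_topology X) E"
    and comp: "\<And>f g. f \<in> E \<Longrightarrow> g \<in> E \<Longrightarrow> compose (topspace X) f g \<in> E"
    and inj: "\<And>f. f \<in> E \<Longrightarrow> inj_on f (topspace X)"
    and q: "q \<in> E"
  obtains r where "r \<in> E" "\<And>x. x \<in> topspace X \<Longrightarrow> r (q x) = x" "\<And>x. x \<in> topspace X \<Longrightarrow> q (r x) = x"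
proof -
  let ?P = "self_map_topology X" and ?c = "compose (topspace X)"
  have cpt: "compact_space ?P"
    using X(1) by (simp add: compact_space_product_topology)
  have haus: "Hausdorff_space ?P"
    using X(2) by (simp add: Hausdorff_space_product_topology)
  have sub: "E \<subseteq> topspace ?P" using E closedin_subset by blast
  have self: "f x \<in> topspace X" if "f \<in> E" "x \<in> topspace X" for f x
    using self_map_memb[OF subsetD[OF sub that(1)]] that(2) by blast
  define F where "F = (\<lambda>f. ?c f q) ` E"
  have FE: "F \<subseteq> E" using comp q by (auto simp: F_def)
  have "continuous_map ?P ?P (\<lambda>f. ?c f q)"
    by (rule continuous_map_compose_right[OF self_map_memb[OF subsetD[OF sub q]]])
  then have "closedin ?P F"
    unfolding F_def
    by (rule compactin_imp_closedin[OF haus image_compactin[OF closedin_compact_space[OF cpt E]]])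
  moreover have "F \<noteq> {}" using q by (auto simp: F_def)
  moreover have "?c f g \<in> F" if f: "f \<in> F" and g: "g \<in> F" for f g
  proof -
    obtain a where a: "a \<in> E" "g = ?c a q" using g by (auto simp: F_def)
    have "?c f g = ?c (?c f a) q"
      unfolding a(2) by (rule self_map_compose_assoc[OF subsetD[OF sub q]])
    moreover have "?c f a \<in> E" using f FE a(1) comp by blast
    ultimately show ?thesis by (auto simp: F_def)
  qed
  ultimately obtain e where e: "e \<in> F" "?c e e = e"
    using compact_self_map_semigroup_idempotent[OF X] by blast
  have e_id: "e x = x" if "x \<in> topspace X" for x
  proof (rule inj_onD[OF inj])
    show "e \<in> E" using e(1) FE by blast
    show "e (e x) = e x" using e(2) that by (metis compose_eq)
    show "e x \<in> topspace X" using self that e(1) FE by blast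
  qed (use that in auto)
  obtain r where r: "r \<in> E" "e = ?c r q" using e(1) by (auto simp: F_def)
  have rq: "r (q x) = x" if "x \<in> topspace X" for x
    using e_id[OF that] r(2) that by (simp add: compose_eq)
  have "q (r x) = x" if x: "x \<in> topspace X" for x
  proof (rule inj_onD[OF inj[OF r(1)]])
    show "r (q (r x)) = r x" using rq self r(1) x by blast
  qed (use self q r x in auto)
  then show thesis using that r(1) rq by blast
qed

lemma minimal_system_orbit_meets_open:
  assumes cont: "\<And>s. s \<in> S \<Longrightarrow> continuous_map X X (act s)"
    and comp: "\<And>s t. s \<in> S \<Longrightarrow> t \<in> S \<Longrightarrow> \<exists>u\<in>S. \<forall>x\<in>topspace X. act u x = act s (act t x)"
    and min: "\<And>N. closedin X N \<Longrightarrow> N \<noteq> {} \<Longrightarrow> (\<And>s. s \<in> S \<Longrightarrow> act s ` N \<subseteq> N) \<Longrightarrow> N = topspace X"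
    and S: "S \<noteq> {}" and x: "x \<in> topspace X" and V: "openin X V" "V \<noteq> {}"
  obtains s where "s \<in> S" "act s x \<in> V"
proof -
  let ?O = "(\<lambda>s. act s x) ` S"
  have O: "?O \<subseteq> topspace X" using cont x by (auto simp: continuous_map_def)
  have "X closure_of ?O = topspace X"
  proof (rule min)
    show "X closure_of ?O \<noteq> {}" using O S closure_of_subset by fastforce
    fix s assume s: "s \<in> S"
    have "act s ` (X closure_of ?O) \<subseteq> X closure_of (act s ` ?O)"
      using cont[OF s] by (rule continuous_map_image_closure_subset)
    also have "act s ` ?O \<subseteq> ?O" using comp[OF s] x by (force simp: image_iff)
    then have "X closure_of (act s ` ?O) \<subseteq> X closure_of ?O" by (rule closure_of_mono)
    finally show "act s ` (X closure_of ?O) \<subseteq> X closure_of ?O" .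
  qed simp
  moreover obtain v where v: "v \<in> V" "v \<in> topspace X"
    using V openin_subset[OF V(1)] by blast
  ultimately have "v \<in> X closure_of ?O" by simp
  then obtain y where "y \<in> ?O" "y \<in> V"
    unfolding in_closure_of using v(1) V(1) by blast
  then show thesis using that by blast
qed

section \<open>Small weakly open pieces of separable weakly compact sets\<close>

lemma countable_net_closed_convex_hull:
  fixes A :: "'a::real_normed_vector set"
  assumes A: "countable A" and e: "e > 0"
  obtains D where "countable D" "closure (convex hull A) \<subseteq> (\<Union>d\<in>D. cball d e)"
proof -
  have "\<exists>D. finite D \<and> convex hull F \<subseteq> (\<Union>d\<in>D. ball d (e/2))" if "finite F" for F :: "'a set"
  proof -
    have "convex hull F \<subseteq> (\<Union>d\<in>convex hull F. ball d (e/2))" using e by force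
    from compactE_image[OF finite_imp_compact_convex_hull[OF \<open>finite F\<close>] open_ball this]
    obtain D where "finite D" "convex hull F \<subseteq> (\<Union>d\<in>D. ball d (e/2))" .
    then show ?thesis by blast
  qed
  then have "\<forall>F :: 'a set. \<exists>D. finite F \<longrightarrow> finite D \<and> convex hull F \<subseteq> (\<Union>d\<in>D. ball d (e/2))"
    by blast
  from choice[OF this] obtain D where
    D: "\<And>F :: 'a set. finite F \<Longrightarrow> finite (D F) \<and> convex hull F \<subseteq> (\<Union>d\<in>D F. ball d (e/2))"
    by blast
  define E where "E = (\<Union>F\<in>{F. finite F \<and> F \<subseteq> A}. D F)"
  have "countable E"
    unfolding E_def using A D
    by (intro countable_UN countable_Collect_finite_subset) (auto intro: countable_finite)
  moreover have "\<exists>d\<in>E. x \<in> cball d e" if x: "x \<in> closure (convex hull A)" for x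
  proof -
    obtain y where y: "y \<in> convex hull A" "dist y x < e/2"
      using x e by (meson closure_approachable half_gt_zero)
    obtain F where F: "finite F" "F \<subseteq> A" "y \<in> convex hull F"
      using y(1) unfolding convex_hull_explicit[of A] by (force simp: convex_hull_finite)
    have "y \<in> (\<Union>d\<in>D F. ball d (e/2))" using subsetD[OF conjunct2[OF D[OF F(1)]] F(3)] .
    then obtain d where d: "d \<in> D F" "dist d y < e/2" by auto
    then have "dist d x \<le> e"
      using dist_triangle[of d x y] y(2) by simp
    then show ?thesis using d(1) F by (auto simp: E_def)
  qed
  then have "closure (convex hull A) \<subseteq> (\<Union>d\<in>E. cball d e)" by blast
  ultimately show thesis by (rule that)
qed

text \<open>Closed balls are weakly closed, so a countable cover by small balls is a countable cover of a
  compact Hausdorff space by closed sets, and Baire's theorem gives one of them interior.\<close>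

lemma weakly_compact_small_open_piece:
  fixes M :: "'a::real_normed_vector set"
  assumes M: "compactin weak_topology M" "M \<noteq> {}"
    and D: "countable D" "M \<subseteq> (\<Union>d\<in>D. cball d e)"
  obtains W where "openin weak_topology W" "W \<inter> M \<noteq> {}"
    "\<And>a b. a \<in> W \<inter> M \<Longrightarrow> b \<in> W \<inter> M \<Longrightarrow> norm (a - b) \<le> 2 * e"
proof -
  let ?X = "subtopology weak_topology M"
  let ?G = "(\<lambda>d. M \<inter> cball d e) ` D"
  have cpt: "compact_space ?X" using M(1) by (rule compact_space_subtopology)
  have haus: "Hausdorff_space ?X" by (simp add: Hausdorff_space_subtopology Hausdorff_weak_topology)
  have clo: "closedin ?X (M \<inter> cball d e)" for d
    using closed_convex_imp_weakly_closed[OF closed_cball convex_cball, of d e]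
    unfolding closedin_subtopology by blast
  have "?X interior_of \<Union>?G \<noteq> {}"
  proof -
    have "\<Union>?G = topspace ?X" using D(2) by auto
    then have "?X interior_of \<Union>?G = topspace ?X" using interior_of_topspace by metis
    then show ?thesis using M(2) by simp
  qed
  then obtain T where T: "T \<in> ?G" "?X interior_of T \<noteq> {}"
    using Baire_category_alt[of ?X ?G] cpt haus clo D(1)
    by (metis (no_types, lifting) compact_imp_locally_compact_space compact_Hausdorff_imp_regular_space
        countable_image imageE)
  then obtain d where d: "T = M \<inter> cball d e" by blast
  obtain W where W: "openin weak_topology W" "?X interior_of T = W \<inter> M"
    using openin_interior_of[of ?X T] unfolding openin_subtopology by blast
  have "norm (a - b) \<le> 2 * e" if "a \<in> W \<inter> M" "b \<in> W \<inter> M" for a b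
  proof -
    have "a \<in> cball d e" "b \<in> cball d e"
      using that W(2) interior_of_subset[of ?X T] d by auto
    then show ?thesis
      using dist_triangle2[of a b d] by (simp add: dist_norm norm_minus_commute)
  qed
  then show thesis using that[OF W(1)] W(2) T(2) by auto
qed

section \<open>Minimal distal systems of nonexpansive maps\<close>

locale minimal_distal_system =
  fixes M :: "'a::real_normed_vector set" and S :: "'s set" and act :: "'s \<Rightarrow> 'a \<Rightarrow> 'a"
  assumes compact: "compactin weak_topology M" and nonempty: "M \<noteq> {}"
    and S_countable: "countable S" and S_nonempty: "S \<noteq> {}"
    and cont: "\<And>s. s \<in> S \<Longrightarrow>
      continuous_map (subtopology weak_topology M) (subtopology weak_topology M) (act s)"
    and comp: "\<And>s t. s \<in> S \<Longrightarrow> t \<in> S \<Longrightarrow> \<exists>u\<in>S. \<forall>x\<in>M. act u x = act s (act t x)"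
    and minimal: "\<And>N. closedin (subtopology weak_topology M) N \<Longrightarrow> N \<noteq> {} \<Longrightarrow>
      (\<And>s. s \<in> S \<Longrightarrow> act s ` N \<subseteq> N) \<Longrightarrow> N = M"
    and nonexpansive: "nonexpansive_action S M act"
    and distal: "norm_distal S M act"
begin

abbreviation X where "X \<equiv> subtopology weak_topology M"

lemma compact_X: "compact_space X" and Hausdorff_X: "Hausdorff_space X" and topspace_X: "topspace X = M"
  using compact by (auto simp: compact_space_subtopology Hausdorff_space_subtopology Hausdorff_weak_topology)

lemma act_in: "s \<in> S \<Longrightarrow> x \<in> M \<Longrightarrow> act s x \<in> M"
  using cont[of s] by (auto simp: continuous_map_def Pi_iff)

lemma orbit_meets_open:
  assumes x: "x \<in> M" and W: "openin weak_topology W" "W \<inter> M \<noteq> {}"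
  obtains s where "s \<in> S" "act s x \<in> W"
proof -
  have WM: "openin X (W \<inter> M)" using W(1) by (auto simp: openin_subtopology)
  obtain s where "s \<in> S" "act s x \<in> W \<inter> M"
    by (rule minimal_system_orbit_meets_open[of S X act x "W \<inter> M"])
      (use cont comp minimal S_nonempty x WM W(2) in \<open>simp_all add: topspace_X\<close>)
  then show thesis using that by blast
qed

text \<open>The whole set lies in the closed convex hull of a single countable orbit, which is weakly
  closed by Mazur's theorem.\<close>

lemma small_open_piece:
  assumes e: "e > 0"
  obtains W where "openin weak_topology W" "W \<inter> M \<noteq> {}"
    "\<And>a b. a \<in> W \<inter> M \<Longrightarrow> b \<in> W \<inter> M \<Longrightarrow> norm (a - b) < e"
proof -
  obtain x where x: "x \<in> M" using nonempty by blast
  define C where "C = closure (convex hull ((\<lambda>s. act s x) ` S))"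
  have C: "closedin weak_topology C"
    unfolding C_def by (intro closed_convex_imp_weakly_closed) auto
  have orbit: "act s x \<in> C" if "s \<in> S" for s
    unfolding C_def using that by (meson closure_subset hull_inc image_eqI subsetD)
  have "M \<subseteq> C"
  proof (rule ccontr)
    assume "\<not> M \<subseteq> C"
    then have "(UNIV - C) \<inter> M \<noteq> {}" by auto
    moreover have "openin weak_topology (UNIV - C)"
      using C by (metis closedin_def topspace_weak_topology)
    ultimately show False using orbit_meets_open[OF x] orbit by (metis DiffD2)
  qed
  moreover obtain D where D: "countable D" "C \<subseteq> (\<Union>d\<in>D. cball d (e/3))"
    using countable_net_closed_convex_hull[of "(\<lambda>s. act s x) ` S" "e/3"] S_countable e
    unfolding C_def by auto
  ultimately have "M \<subseteq> (\<Union>d\<in>D. cball d (e/3))" by blast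
  then obtain W where W: "openin weak_topology W" "W \<inter> M \<noteq> {}"
    and small: "\<And>a b. a \<in> W \<inter> M \<Longrightarrow> b \<in> W \<inter> M \<Longrightarrow> norm (a - b) \<le> 2 * (e/3)"
    using weakly_compact_small_open_piece[OF compact nonempty D(1)] by metis
  have "2 * (e/3) < e" using e by simp
  then show thesis using that[OF W] small le_less_trans by blast
qed

text \<open>The Ellis semigroup of the system.\<close>

definition enveloping :: "('a \<Rightarrow> 'a) set"
  where "enveloping = self_map_topology X closure_of ((\<lambda>s. restrict (act s) M) ` S)"

lemma restrict_act_in_space: "s \<in> S \<Longrightarrow> restrict (act s) M \<in> topspace (self_map_topology X)"
  using act_in[of s] by (auto simp: topspace_X)

lemma restrict_act_in_enveloping: "s \<in> S \<Longrightarrow> restrict (act s) M \<in> enveloping"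
  unfolding enveloping_def
  by (rule subsetD[OF closure_of_subset[OF image_subsetI[OF restrict_act_in_space]]]) auto

lemma closedin_enveloping: "closedin (self_map_topology X) enveloping"
  unfolding enveloping_def by simp

lemma enveloping_maps: "f \<in> enveloping \<Longrightarrow> x \<in> M \<Longrightarrow> f x \<in> M"
  using self_map_memb[OF subsetD[OF closedin_subset[OF closedin_enveloping]], of f]
  unfolding topspace_X by (rule funcset_mem)

lemma compose_in_enveloping:
  assumes "f \<in> enveloping" "g \<in> enveloping"
  shows "compose M f g \<in> enveloping"
proof -
  let ?G = "(\<lambda>s. restrict (act s) M) ` S"
  have "?G \<subseteq> topspace (self_map_topology X)" using restrict_act_in_space by blast
  moreover have "continuous_map X X g" if g: "g \<in> ?G" for g
  proof -
    obtain s where s: "s \<in> S" "g = restrict (act s) M" using g by blast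
    show ?thesis by (rule continuous_map_eq[OF cont[OF s(1)]]) (simp add: s(2))
  qed
  moreover have "compose (topspace X) f g \<in> ?G" if fg: "f \<in> ?G" "g \<in> ?G" for f g
  proof -
    obtain s t where st: "s \<in> S" "f = restrict (act s) M" "t \<in> S" "g = restrict (act t) M"
      using fg by blast
    obtain u where u: "u \<in> S" "\<forall>x\<in>M. act u x = act s (act t x)" using comp st by blast
    have "compose (topspace X) f g = restrict (act u) M"
      using u act_in st by (auto simp: compose_def topspace_X fun_eq_iff)
    then show ?thesis using u by blast
  qed
  ultimately show ?thesis
    using closure_of_closed_under_compose[of ?G X f g] assms unfolding enveloping_def topspace_X
    by blast
qed

text \<open>The condition on \<open>f\<close> is closed for pointwise weak convergence, since balls are weakly closed.\<close>

lemma enveloping_nonexpansive: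
  assumes f: "f \<in> enveloping" and xy: "x \<in> M" "y \<in> M"
  shows "norm (f x - f y) \<le> norm (x - y)"
proof -
  let ?P = "self_map_topology X"
  have ev: "continuous_map ?P weak_topology (\<lambda>f. f z)" if "z \<in> M" for z
    using continuous_map_evaluation[of z X] that by (simp add: topspace_X continuous_map_in_subtopology)
  have "closedin ?P {f \<in> topspace ?P. f x - f y \<in> cball 0 (norm (x - y))}"
    using continuous_map_weak_diff[OF ev[OF xy(1)] ev[OF xy(2)]]
    by (rule closedin_continuous_map_preimage) (intro closed_convex_imp_weakly_closed closed_cball convex_cball)
  then have "f x - f y \<in> cball 0 (norm (x - y))"
    using f nonexpansive xy unfolding enveloping_def nonexpansive_action_def
    by (elim forall_in_closure_of) auto
  then show ?thesis by simp
qed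

text \<open>This is where norm-distality enters. If \<open>p x = p y\<close>, minimality moves this point by some \<open>t \<in> S\<close>
  into a weakly open set \<open>W\<close> whose part in \<open>M\<close> is small in norm. By weak continuity of \<open>t\<close>, elements
  \<open>s \<in> S\<close> close to \<open>p\<close> send both \<open>t s x\<close> and \<open>t s y\<close> into \<open>W\<close>, so weak proximality of \<open>x\<close> and \<open>y\<close>
  becomes norm proximality.\<close>

lemma enveloping_injective:
  assumes p: "p \<in> enveloping"
  shows "inj_on p M"
proof (rule inj_onI, rule ccontr)
  fix x y assume xy: "x \<in> M" "y \<in> M" "p x = p y" "x \<noteq> y"
  let ?P = "self_map_topology X"
  have "0 \<notin> closure {act s x - act s y |s. s \<in> S}"
    using distal xy unfolding norm_distal_def by blast
  then obtain e where e: "e > 0" "\<And>s. s \<in> S \<Longrightarrow> e \<le> norm (act s x - act s y)"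
    unfolding closure_approachable by (force simp: not_less)
  obtain W where W: "openin weak_topology W" "W \<inter> M \<noteq> {}"
    "\<And>a b. a \<in> W \<inter> M \<Longrightarrow> b \<in> W \<inter> M \<Longrightarrow> norm (a - b) < e"
    using small_open_piece[OF e(1)] by metis
  obtain t where t: "t \<in> S" "act t (p x) \<in> W"
    using orbit_meets_open[OF enveloping_maps[OF p xy(1)] W(1,2)] by blast
  define V where "V = {z \<in> topspace X. act t z \<in> W \<inter> M}"
  have "openin X (W \<inter> M)" using W(1) by (auto simp: openin_subtopology)
  then have V: "openin X V"
    unfolding V_def by (rule openin_continuous_map_preimage[OF cont[OF t(1)]])
  have N: "openin ?P ({f \<in> topspace ?P. f x \<in> V} \<inter> {f \<in> topspace ?P. f y \<in> V})" (is "openin _ ?N")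
    using V xy
    by (intro openin_Int openin_continuous_map_preimage[OF continuous_map_evaluation]) (auto simp: topspace_X)
  have "p \<in> topspace ?P"
    by (rule subsetD[OF closedin_subset[OF closedin_enveloping] p])
  moreover have "p x \<in> V" "p y \<in> V"
    using t xy act_in enveloping_maps[OF p] by (auto simp: V_def topspace_X)
  ultimately have pN: "p \<in> ?N" by blast
  obtain g where g: "g \<in> (\<lambda>s. restrict (act s) M) ` S" "g \<in> ?N"
    using p[unfolded enveloping_def in_closure_of, THEN conjunct2, THEN spec, THEN mp, OF conjI[OF pN N]]
    by (elim exE conjE)
  then obtain s where s: "s \<in> S" "act t (act s x) \<in> W \<inter> M" "act t (act s y) \<in> W \<inter> M"
    using xy by (auto simp: V_def)
  obtain u where u: "u \<in> S" "\<forall>z\<in>M. act u z = act t (act s z)" using comp t(1) s(1) by blast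
  then have "norm (act u x - act u y) < e" using W(3) s(2,3) xy by simp
  then show False using e(2)[OF u(1)] by simp
qed

text \<open>In the group \<open>enveloping\<close> both a map and its inverse are nonexpansive.\<close>

lemma act_isometry_onto:
  assumes s: "s \<in> S"
  shows "\<And>x y. x \<in> M \<Longrightarrow> y \<in> M \<Longrightarrow> norm (act s x - act s y) = norm (x - y)"
    and "act s ` M = M"
proof -
  obtain r where r: "r \<in> enveloping" "\<And>x. x \<in> M \<Longrightarrow> r (restrict (act s) M x) = x"
    "\<And>x. x \<in> M \<Longrightarrow> restrict (act s) M (r x) = x"
  proof (rule compact_injective_semigroup_inverse[OF compact_X Hausdorff_X closedin_enveloping _ _
        restrict_act_in_enveloping[OF s]])
  qed (simp_all add: topspace_X compose_in_enveloping enveloping_injective)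
  have left: "r (act s x) = x" and right: "act s (r x) = x" if "x \<in> M" for x
    using r(2,3)[OF that] enveloping_maps[OF r(1) that] that by simp_all
  show "norm (act s x - act s y) = norm (x - y)" if "x \<in> M" "y \<in> M" for x y
  proof (rule antisym)
    show "norm (act s x - act s y) \<le> norm (x - y)"
      using nonexpansive s that unfolding nonexpansive_action_def by blast
    show "norm (x - y) \<le> norm (act s x - act s y)"
      using enveloping_nonexpansive[OF r(1) act_in[OF s that(1)] act_in[OF s that(2)]] left that
      by simp
  qed
  show "act s ` M = M"
    using act_in[OF s] right[symmetric] enveloping_maps[OF r(1)] by blast
qed

text \<open>Finitely many preimages under elements of \<open>S\<close> of one small weakly open piece cover \<open>M\<close>, and
  they are as small as the piece itself because \<open>S\<close> acts by isometries.\<close>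

lemma finite_net:
  assumes e: "e > 0"
  obtains F where "finite F" "F \<subseteq> M" "\<And>x. x \<in> M \<Longrightarrow> \<exists>c\<in>F. norm (c - x) < e"
proof -
  obtain W where W: "openin weak_topology W" "W \<inter> M \<noteq> {}"
    "\<And>a b. a \<in> W \<inter> M \<Longrightarrow> b \<in> W \<inter> M \<Longrightarrow> norm (a - b) < e"
    using small_open_piece[OF e] by metis
  define V where "V = (\<lambda>s. {x \<in> topspace X. act s x \<in> W \<inter> M})"
  have WM: "openin X (W \<inter> M)" using W(1) by (auto simp: openin_subtopology)
  have "openin X (V s)" if "s \<in> S" for s
    unfolding V_def using cont[OF that] WM by (rule openin_continuous_map_preimage)
  moreover have "topspace X \<subseteq> \<Union>(V ` S)"
  proof
    fix x assume x: "x \<in> topspace X"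
    then obtain s where "s \<in> S" "act s x \<in> W"
      using orbit_meets_open[OF _ W(1,2)] topspace_X by metis
    then show "x \<in> \<Union>(V ` S)" using x act_in by (auto simp: V_def)
  qed
  ultimately obtain \<F> where "finite \<F>" "\<F> \<subseteq> V ` S" "topspace X \<subseteq> \<Union>\<F>"
    using compact_X unfolding compact_space_alt by (metis (no_types, lifting) imageE)
  then obtain T where T: "finite T" "T \<subseteq> S" "topspace X \<subseteq> \<Union>(V ` T)"
    by (metis finite_subset_image)
  define F where "F = (\<lambda>s. SOME c. c \<in> V s) ` {s \<in> T. V s \<noteq> {}}"
  have pick: "(SOME c. c \<in> V s) \<in> V s" if "V s \<noteq> {}" for s
    using that by (simp add: some_in_eq)
  show thesis
  proof (rule that)
    show "finite F" using T(1) by (simp add: F_def)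
    show "F \<subseteq> M" using pick by (auto simp: F_def V_def)
    fix x assume "x \<in> M"
    then obtain s where s: "s \<in> T" "x \<in> V s" using T(3) topspace_X by blast
    define c where "c = (SOME c. c \<in> V s)"
    have c: "c \<in> V s" unfolding c_def using s(2) by (intro pick) blast
    then have "norm (c - x) = norm (act s c - act s x)"
      using act_isometry_onto(1)[of s c x] s T(2) by (auto simp: V_def)
    also have "\<dots> < e" using c s(2) by (intro W(3)) (auto simp: V_def)
    finally show "\<exists>c\<in>F. norm (c - x) < e"
      using s by (auto simp: F_def c_def)
  qed
qed

end

section \<open>The fixed point\<close>

text \<open>The mean \<open>u\<close> of a finite \<open>d/2\<close>-net of \<open>M\<close>, where \<open>d\<close> is the diameter: every \<open>m \<in> M\<close> has
  distance at most \<open>d\<close> from all points of the net and less than \<open>d/2\<close> from one of them, so its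
  distance from \<open>u\<close> is bounded by \<open>d - d/(2n)\<close>, with \<open>n\<close> the size of the net.\<close>

lemma totally_bounded_nondiametral_point:
  fixes M :: "'a::real_normed_vector set"
  assumes net: "\<And>e. e > 0 \<Longrightarrow> \<exists>F. finite F \<and> F \<subseteq> M \<and> (\<forall>x\<in>M. \<exists>c\<in>F. norm (c - x) < e)"
    and ab: "a \<in> M" "b \<in> M" "a \<noteq> b"
  obtains u r where "u \<in> convex hull M" "\<And>m. m \<in> M \<Longrightarrow> norm (u - m) \<le> r"
    "\<exists>m\<in>M. \<exists>m'\<in>M. r < norm (m - m')"
proof -
  have bdd: "bounded M"
  proof -
    obtain F where F: "finite F" "\<And>x. x \<in> M \<Longrightarrow> \<exists>c\<in>F. norm (c - x) < 1"
      using net[of 1] by auto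
    have "M \<subseteq> (\<Union>c\<in>F. ball c 1)" using F(2) by (fastforce simp: dist_norm)
    moreover have "bounded (\<Union>c\<in>F. ball c 1)" using F(1) by (intro bounded_UN) auto
    ultimately show ?thesis by (rule bounded_subset[rotated])
  qed
  define d where "d = diameter M"
  have le_d: "norm (x - y) \<le> d" if "x \<in> M" "y \<in> M" for x y
    using diameter_bounded_bound[OF bdd that] by (simp add: d_def dist_norm)
  have "0 < norm (a - b)" using ab(3) by simp
  then have d: "d > 0" using le_d[OF ab(1,2)] by linarith
  obtain F where F: "finite F" "F \<subseteq> M" "\<And>x. x \<in> M \<Longrightarrow> \<exists>c\<in>F. norm (c - x) < d/2"
    using net[of "d/2"] d by auto
  define n where "n = real (card F)"
  have "F \<noteq> {}" using F(3)[OF ab(1)] by blast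
  then have card_pos: "1 \<le> card F" using F(1) by (simp add: Suc_le_eq card_gt_0_iff)
  then have n: "n > 0" by (simp add: n_def)
  define u where "u = (\<Sum>c\<in>F. (1/n) *\<^sub>R c)"
  define r where "r = d - d / (2 * n)"
  have weights: "(\<Sum>c\<in>F. 1/n) = 1" using n by (simp add: n_def)
  have "u \<in> convex hull M"
    unfolding u_def
    by (rule convex_sum[OF F(1) convex_convex_hull weights]) (use n F(2) in \<open>auto intro: hull_inc\<close>)
  moreover have "norm (u - m) \<le> r" if m: "m \<in> M" for m
  proof -
    obtain c where c: "c \<in> F" "norm (c - m) < d/2" using F(3)[OF m] by blast
    have "(\<Sum>c\<in>F. (1/n) *\<^sub>R m) = m"
      using weights by (simp only: scaleR_left.sum[symmetric] scaleR_one)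
    then have "u - m = (\<Sum>c\<in>F. (1/n) *\<^sub>R (c - m))"
      by (simp add: u_def scaleR_right_diff_distrib sum_subtractf)
    also have "norm \<dots> \<le> (\<Sum>c\<in>F. (1/n) * norm (c - m))"
      using n by (intro sum_norm_le) simp
    also have "\<dots> = (1/n) * norm (c - m) + (\<Sum>c\<in>F - {c}. (1/n) * norm (c - m))"
      using F(1) c(1) by (rule sum.remove)
    also have "\<dots> \<le> (1/n) * (d/2) + (\<Sum>c\<in>F - {c}. (1/n) * d)"
      using n c(2) le_d F(2) m by (intro add_mono mult_left_mono sum_mono) auto
    also have "(\<Sum>c\<in>F - {c}. (1/n) * d) = (n - 1) * ((1/n) * d)"
      using F(1) c(1) card_pos by (simp add: n_def card_Diff_singleton of_nat_diff)
    also have "(1/n) * (d/2) + (n - 1) * ((1/n) * d) = r"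
      using n by (simp add: r_def field_simps)
    finally show ?thesis .
  qed
  moreover have "\<exists>m\<in>M. \<exists>m'\<in>M. r < norm (m - m')"
  proof (rule ccontr)
    assume "\<not> ?thesis"
    then have "dist m m' \<le> r" if "m \<in> M" "m' \<in> M" for m m'
      using that by (force simp: dist_norm not_less)
    then have "d \<le> r"
      unfolding d_def using ab(1) by (intro diameter_le) (auto simp: dist_norm)
    moreover have "d / (2 * n) > 0" using d n by simp
    ultimately show False by (simp add: r_def)
  qed
  ultimately show thesis by (rule that)
qed

text \<open>A minimal invariant set \<open>M\<close> inside a minimal invariant convex set \<open>K\<close>. Were \<open>M\<close> not a single
  point, the points of \<open>K\<close> within distance \<open>r\<close> of all of \<open>M\<close>, for a suitable \<open>r\<close> below the diameter
  of \<open>M\<close>, would form a proper nonempty invariant convex subset of \<open>K\<close>.\<close>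

lemma countable_distal_system_fixed_point:
  fixes Q :: "'a::real_normed_vector set" and S :: "'s set" and act :: "'s \<Rightarrow> 'a \<Rightarrow> 'a"
  assumes Q: "Q \<noteq> {}" "compactin weak_topology Q" "convex Q"
    and S: "countable S" "S \<noteq> {}"
    and cont: "\<And>s. s \<in> S \<Longrightarrow>
      continuous_map (subtopology weak_topology Q) (subtopology weak_topology Q) (act s)"
    and comp: "\<And>s t. s \<in> S \<Longrightarrow> t \<in> S \<Longrightarrow> \<exists>u\<in>S. \<forall>x\<in>Q. act u x = act s (act t x)"
    and nonexp: "nonexpansive_action S Q act"
    and distal: "norm_distal S Q act"
  obtains x where "x \<in> Q" "\<And>s. s \<in> S \<Longrightarrow> act s x = x"
proof -
  let ?Q = "subtopology weak_topology Q"
  have cpt: "compact_space ?Q" using Q(2) by (rule compact_space_subtopology)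
  have Q_closed: "closedin weak_topology Q"
    using compactin_imp_closedin[OF Hausdorff_weak_topology Q(2)] .
  have closed_iff: "closedin ?Q C \<longleftrightarrow> closedin weak_topology C \<and> C \<subseteq> Q" for C
    using Q_closed by (rule closedin_closed_subtopology)
  define invariant where "invariant = (\<lambda>C. \<forall>s\<in>S. act s ` C \<subseteq> C)"
  have inv_Q: "invariant Q"
    unfolding invariant_def using cont by (auto simp: continuous_map_def Pi_iff)
  obtain K where K: "closedin ?Q K" "K \<noteq> {}" "convex K \<and> invariant K" "K \<subseteq> Q"
    and K_min: "\<And>N. closedin ?Q N \<Longrightarrow> N \<noteq> {} \<Longrightarrow> convex N \<and> invariant N \<Longrightarrow> N \<subseteq> K \<Longrightarrow> N = K"
  proof (rule minimal_closed_set[OF cpt, of Q "\<lambda>C. convex C \<and> invariant C"])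
    show "convex (\<Inter>\<C>) \<and> invariant (\<Inter>\<C>)"
      if "\<C> \<noteq> {}" and \<C>: "\<And>C. C \<in> \<C> \<Longrightarrow> C \<subseteq> Q \<and> convex C \<and> invariant C" for \<C>
    proof
      show "convex (\<Inter>\<C>)" using \<C> by (intro convex_Inter) blast
      show "invariant (\<Inter>\<C>)" using \<C> unfolding invariant_def by fast
    qed
  qed (use Q inv_Q closedin_topspace[of ?Q] in auto)
  obtain M where M: "closedin ?Q M" "M \<noteq> {}" "invariant M" "M \<subseteq> K"
    and M_min: "\<And>N. closedin ?Q N \<Longrightarrow> N \<noteq> {} \<Longrightarrow> invariant N \<Longrightarrow> N \<subseteq> M \<Longrightarrow> N = M"
  proof (rule minimal_closed_set[OF cpt K(1,2), of invariant])
    show "invariant (\<Inter>\<C>)" if "\<C> \<noteq> {}" and \<C>: "\<And>C. C \<in> \<C> \<Longrightarrow> C \<subseteq> K \<and> invariant C" for \<C>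
      using \<C> unfolding invariant_def by fast
  qed (use K in auto)
  have MQ: "M \<subseteq> Q" using M(4) K(4) by blast
  have M_closed: "closedin weak_topology M" using M(1) closed_iff by blast
  interpret minimal_distal_system M S act
  proof
    show "compactin weak_topology M" using closed_compactin[OF Q(2) MQ M_closed] .
    show "continuous_map (subtopology weak_topology M) (subtopology weak_topology M) (act s)"
      if s: "s \<in> S" for s
    proof -
      have "continuous_map (subtopology ?Q M) (subtopology ?Q M) (act s)"
        using M(3) s continuous_map_from_subtopology[OF cont[OF s], of M]
        by (auto simp: continuous_map_in_subtopology invariant_def)
      then show ?thesis using MQ by (simp add: subtopology_subtopology inf.absorb2)
    qed
    show "N = M" if N: "closedin (subtopology weak_topology M) N" "N \<noteq> {}"
      and inv: "\<And>s. s \<in> S \<Longrightarrow> act s ` N \<subseteq> N" for N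
    proof -
      have "closedin weak_topology N" "N \<subseteq> M"
        using N(1) closedin_closed_subtopology[OF M_closed] by blast+
      then show ?thesis using N(2) inv MQ by (intro M_min) (auto simp: closed_iff invariant_def)
    qed
    show "\<exists>u\<in>S. \<forall>x\<in>M. act u x = act s (act t x)" if "s \<in> S" "t \<in> S" for s t
      using comp[OF that] MQ by blast
    show "nonexpansive_action S M act"
      using nonexp MQ unfolding nonexpansive_action_def by blast
    show "norm_distal S M act"
      using distal MQ unfolding norm_distal_def by blast
  qed (use M S in auto)
  have "a = b" if ab: "a \<in> M" "b \<in> M" for a b
  proof (rule ccontr)
    assume "a \<noteq> b"
    have net: "\<exists>F. finite F \<and> F \<subseteq> M \<and> (\<forall>x\<in>M. \<exists>c\<in>F. norm (c - x) < e)" if "e > 0" for e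
      using finite_net[OF that] by metis
    obtain u r where u: "u \<in> convex hull M" and r: "\<And>m. m \<in> M \<Longrightarrow> norm (u - m) \<le> r"
      and far: "\<exists>m\<in>M. \<exists>m'\<in>M. r < norm (m - m')"
      using totally_bounded_nondiametral_point[OF net ab \<open>a \<noteq> b\<close>] by metis
    define K' where "K' = K \<inter> (\<Inter>m\<in>M. cball m r)"
    have "K' = K"
    proof (rule K_min)
      have "closedin weak_topology (\<Inter>m\<in>M. cball m r)"
        by (intro closed_convex_imp_weakly_closed closed_INT convex_INT ballI closed_cball convex_cball)
      then show "closedin ?Q K'"
        using K(1) unfolding closed_iff K'_def by (auto intro: closedin_Int)
      have "u \<in> K" using u hull_minimal[of M K convex] M(4) K(3) by blast
      then have "u \<in> K'"
        using r by (auto simp: K'_def dist_norm norm_minus_commute)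
      then show "K' \<noteq> {}" by blast
      have "convex K'"
        unfolding K'_def using K(3) by (intro convex_Int convex_INT convex_cball) auto
      moreover have "act s x \<in> K'" if s: "s \<in> S" and x: "x \<in> K'" for s x
      proof -
        have "norm (m - act s x) \<le> r" if m: "m \<in> M" for m
        proof -
          \<comment> \<open>Since \<open>s\<close> maps \<open>M\<close> onto itself, \<open>m\<close> has a preimage \<open>m'\<close>, within \<open>r\<close> of \<open>x\<close>.\<close>
          obtain m' where m': "m' \<in> M" "m = act s m'"
            using act_isometry_onto(2)[OF s] m by blast
          have "norm (act s m' - act s x) \<le> norm (m' - x)"
            using nonexp s m'(1) x MQ K(4) unfolding nonexpansive_action_def K'_def by blast
          also have "\<dots> \<le> r" using x m'(1) by (auto simp: K'_def dist_norm)
          finally show ?thesis by (simp add: m'(2))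
        qed
        moreover have "act s x \<in> K" using x s K(3) by (auto simp: K'_def invariant_def)
        ultimately show ?thesis by (simp add: K'_def dist_norm)
      qed
      ultimately show "convex K' \<and> invariant K'" by (auto simp: invariant_def)
    qed (simp add: K'_def)
    have "norm (m - m') \<le> r" if "m \<in> M" "m' \<in> M" for m m'
    proof -
      have "m \<in> K'" using \<open>K' = K\<close> that(1) M(4) by blast
      then show ?thesis using that(2) by (auto simp: K'_def dist_norm norm_minus_commute)
    qed
    then show False using far by (meson not_less)
  qed
  moreover obtain x where "x \<in> M" using M(2) by blast
  ultimately show thesis using that[of x] act_in MQ by blast
qed

text \<open>The subsemigroup generated by a countable set consists of the products of its nonempty words.\<close>

lemma countable_generated_subsemigroup:
  assumes S: "semigroup_on S mul" and F: "F \<subseteq> S" "countable F"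
  obtains T where "F \<subseteq> T" "T \<subseteq> S" "countable T" "\<And>s t. s \<in> T \<Longrightarrow> t \<in> T \<Longrightarrow> mul s t \<in> T"
proof -
  define T where "T = (\<lambda>(w, x). foldr mul w x) ` (lists F \<times> F)"
  have in_S: "foldr mul w x \<in> S" if "w \<in> lists F" "x \<in> S" for w x
    using that F S by (induction w) (auto simp: semigroup_on_def)
  have TS: "T \<subseteq> S" using in_S F by (auto simp: T_def)
  have mul: "mul (foldr mul w x) t = foldr mul (w @ [x]) t" if "w \<in> lists F" "x \<in> F" "t \<in> S" for w x t
    using that(1)
  proof (induction w)
    case (Cons a w)
    then have "mul (mul a (foldr mul w x)) t = mul a (mul (foldr mul w x) t)"
      using S F in_S[of w x] that unfolding semigroup_on_def by (meson in_listsD list.set_intros subsetD Cons_in_lists_iff)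
    then show ?case using Cons by simp
  qed simp
  show thesis
  proof (rule that[of T])
    show "F \<subseteq> T"
    proof
      fix x assume "x \<in> F"
      then have "([], x) \<in> lists F \<times> F" by simp
      then show "x \<in> T" unfolding T_def by (rule rev_image_eqI) simp
    qed
    show "countable T" using F by (auto simp: T_def)
    fix s t assume "s \<in> T" "t \<in> T"
    then obtain w x v y where w: "w \<in> lists F" "x \<in> F" "s = foldr mul w x"
      and v: "v \<in> lists F" "y \<in> F" "t = foldr mul v y"
      by (auto simp: T_def)
    have prod: "mul s t = foldr mul (w @ [x] @ v) y"
      using mul[OF w(1,2)] \<open>t \<in> T\<close> TS w(3) v(3) by (simp add: subset_iff)
    have "w @ [x] @ v \<in> lists F" using w v by simp
    then have "(w @ [x] @ v, y) \<in> lists F \<times> F" using v(2) by simp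
    then show "mul s t \<in> T" unfolding T_def by (rule rev_image_eqI) (simp add: prod)
  qed (rule TS)
qed

theorem corollary3p4:
  fixes Q :: "'a::banach set"
    and S :: "'s set"
    and mul :: "'s \<Rightarrow> 's \<Rightarrow> 's"
    and act :: "'s \<Rightarrow> 'a \<Rightarrow> 'a"
  assumes "Q \<noteq> {}"
    and "compactin weak_topology Q"
    and "convex Q"
    and "dynamical_system S mul (subtopology weak_topology Q) act"
    and "nonexpansive_action S Q act"
    and "norm_distal S Q act"
  shows "\<exists>x\<in>Q. \<forall>s\<in>S. act s x = x"
proof -
  let ?Q = "subtopology weak_topology Q"
  have topQ: "topspace ?Q = Q" by simp
  have sg: "semigroup_on S mul"
    and act_mul: "\<And>s t x. s \<in> S \<Longrightarrow> t \<in> S \<Longrightarrow> x \<in> Q \<Longrightarrow> act (mul s t) x = act s (act t x)"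
    and cont: "\<And>s. s \<in> S \<Longrightarrow> continuous_map ?Q ?Q (act s)"
    using assms(4) unfolding dynamical_system_def topQ by blast+
  have cpt: "compact_space ?Q" using assms(2) by (rule compact_space_subtopology)
  define Fix where "Fix = (\<lambda>s. {x \<in> topspace ?Q. act s x = x})"
  have closed: "closedin ?Q (Fix s)" if "s \<in> S" for s
    unfolding Fix_def
    by (rule closedin_continuous_maps_eq[OF _ cont[OF that] continuous_map_id[unfolded id_def]])
      (simp add: Hausdorff_space_subtopology Hausdorff_weak_topology)
  \<comment> \<open>Finitely many elements generate a countable subsemigroup, to which all hypotheses pass.\<close>
  have finite_Fix: "Q \<inter> (\<Inter>s\<in>F. Fix s) \<noteq> {}" if F: "finite F" "F \<subseteq> S" for F
  proof (cases "F = {}")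
    case False
    obtain T where T: "F \<subseteq> T" "T \<subseteq> S" "countable T" "\<And>s t. s \<in> T \<Longrightarrow> t \<in> T \<Longrightarrow> mul s t \<in> T"
      using countable_generated_subsemigroup[OF sg F(2) countable_finite[OF F(1)]] by metis
    have T_cont: "continuous_map ?Q ?Q (act s)" if "s \<in> T" for s
      using cont T(2) that by blast
    have T_comp: "\<exists>u\<in>T. \<forall>x\<in>Q. act u x = act s (act t x)" if "s \<in> T" "t \<in> T" for s t
      using act_mul[of s t] T(2) T(4)[OF that] that by blast
    have T_nonexp: "nonexpansive_action T Q act"
      using assms(5) T(2) unfolding nonexpansive_action_def by blast
    have "closure {act s x - act s y |s. s \<in> T} \<subseteq> closure {act s x - act s y |s. s \<in> S}" for x y
      using T(2) by (intro closure_mono) blast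
    then have T_distal: "norm_distal T Q act"
      using assms(6) unfolding norm_distal_def by blast
    obtain x where "x \<in> Q" "\<And>s. s \<in> T \<Longrightarrow> act s x = x"
      using countable_distal_system_fixed_point[OF assms(1-3) T(3) _ T_cont T_comp T_nonexp T_distal]
        T(1) False by blast
    then have "x \<in> Q \<inter> (\<Inter>s\<in>F. Fix s)" using T(1) by (auto simp: Fix_def)
    then show ?thesis by blast
  qed (use assms(1) in simp)
  have "\<Inter>\<F> \<noteq> {}" if \<F>: "finite \<F>" "\<F> \<subseteq> Fix ` S" for \<F>
  proof -
    obtain F where "F \<subseteq> S" "finite F" "\<F> = Fix ` F"
      using finite_subset_image[OF \<F>] by blast
    then show ?thesis using finite_Fix[of F] by auto
  qed
  moreover have "\<forall>C\<in>Fix ` S. closedin ?Q C" using closed by blast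
  ultimately have "\<Inter>(Fix ` S) \<noteq> {}"
    using cpt[unfolded compact_space_fip, THEN spec, of "Fix ` S"] by simp
  then obtain x where x: "\<And>s. s \<in> S \<Longrightarrow> x \<in> Fix s" by blast
  show ?thesis
  proof (cases "S = {}")
    case False
    then show ?thesis using x by (auto simp: Fix_def)
  qed (use assms(1) in auto)
qed

end
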